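(* Suppose $L(a,b)=|a-b|^p$ with $p\ge1$, $n=n'$, $d=d'$, and that the weights $\mathbf{w},\mathbf{w}',\mathbf{v},\mathbf{v}'$ are uniform. Then for $\mathbf{X},\mathbf{X}'\in\mathbb{R}^{n\times d}$, $COOT(\mathbf{X},\mathbf{X}')=0$ if and only if there exist a permutation of the samples $\sigma_1\in S_n$ and a permutation of the features $\sigma_2\in S_d$ such that $X_{i,k}=X'_{\sigma_1(i),\sigma_2(k)}$ for all $i,k$. Moreover, $COOT$ is symmetric, and it satisfies the triangle inequality $$COOT(\mathbf{X},\mathbf{X}'')\le COOT(\mathbf{X},\mathbf{X}')+COOT(\mathbf{X}',\mathbf{X}'')$$ as long as $L$ satisfies the triangle inequality.
   Context: For matrices $\mathbf{X}\in\mathbb{R}^{n\times d}$, $\mathbf{X}'\in\mathbb{R}^{n'\times d'}$ with sample weights (probability vectors) $\mathbf{w}\in\Sigma_n,\mathbf{w}'\in\Sigma_{n'}$ and feature weights $\mathbf{v}\in\Sigma_d,\mathbf{v}'\in\Sigma_{d'}$, and $L:\mathbb{R}\times\mathbb{R}\to\mathbb{R}_+$, $$COOT(\mathbf{X},\mathbf{X}')=\min_{\pi^s\in\Pi(\mathbf{w},\mathbf{w}'),\ \pi^v\in\Pi(\mathbf{v},\mathbf{v}')}\ \sum_{i,j,k,l}L(X_{i,k},X'_{j,l})\,\pi^s_{i,j}\,\pi^v_{k,l},$$ where $\Pi(\mathbf{w},\mathbf{w}')$ is the set of nonnegative matrices with row sums $\mathbf{w}$ and column sums $\mathbf{w}'$.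 $S_n$ is the set of permutations of $\{1,\dots,n\}$. Uniform weights are $\mathbf{w}=\mathbf{w}'=\frac1n\mathbf{1}_n$, $\mathbf{v}=\mathbf{v}'=\frac1d\mathbf{1}_d$. *)

theory Defs
  imports "HOL-Analysis.Analysis" "HOL-Combinatorics.Permutations"
begin

text \<open>An \<open>n \<times> d\<close> matrix is a value of type \<open>real^'d^'n\<close>, so that \<open>X $ i $ k\<close> is the entry in row
  (sample) \<open>i\<close> and column (feature) \<open>k\<close>.\<close>

definition prob_vectors :: "(real^'n) set" where
  "prob_vectors = {w. (\<forall>i. 0 \<le> w $ i) \<and> (\<Sum>i\<in>UNIV. w $ i) = 1}"

definition uniform_weights :: "real^'n" where
  "uniform_weights = (\<chi> i. 1 / real CARD('n))"

definition couplings :: "real^'n \<Rightarrow> real^'m \<Rightarrow> (real^'m^'n) set" where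
  "couplings w w' = {P. (\<forall>i j. 0 \<le> P $ i $ j) \<and>
     (\<forall>i. (\<Sum>j\<in>UNIV. P $ i $ j) = w $ i) \<and>
     (\<forall>j. (\<Sum>i\<in>UNIV. P $ i $ j) = w' $ j)}"

definition COOT_cost ::
  "(real \<Rightarrow> real \<Rightarrow> real) \<Rightarrow> real^'d^'n \<Rightarrow> real^'e^'m \<Rightarrow> real^'m^'n \<Rightarrow> real^'e^'d \<Rightarrow> real" where
  "COOT_cost L X X' Ps Pv =
     (\<Sum>i\<in>UNIV. \<Sum>j\<in>UNIV. \<Sum>k\<in>UNIV. \<Sum>l\<in>UNIV.
        L (X $ i $ k) (X' $ j $ l) * Ps $ i $ j * Pv $ k $ l)"

text \<open>The infimum below is a minimum whenever the weights are probability vectors; see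
  \<open>COOT_attained\<close>.\<close>

definition COOT ::
  "(real \<Rightarrow> real \<Rightarrow> real) \<Rightarrow> real^'n \<Rightarrow> real^'m \<Rightarrow> real^'d \<Rightarrow> real^'e \<Rightarrow>
   real^'d^'n \<Rightarrow> real^'e^'m \<Rightarrow> real" where
  "COOT L w w' v v' X X' =
     (INF (Ps, Pv) \<in> couplings w w' \<times> couplings v v'. COOT_cost L X X' Ps Pv)"

lemma uniform_weights_in_prob_vectors: "uniform_weights \<in> prob_vectors"
  by (simp add: uniform_weights_def prob_vectors_def)

lemma couplings_nonempty:
  assumes "w \<in> prob_vectors" "w' \<in> prob_vectors"
  shows "couplings w w' \<noteq> {}"
proof -
  have "(\<chi> i j. w $ i * w' $ j) \<in> couplings w w'"
    using assms
    by (simp add: couplings_def prob_vectors_def flip: sum_distrib_left sum_distrib_right)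
  then show ?thesis by blast
qed

lemma compact_couplings:
  fixes w :: "real^'n" and w' :: "real^'m"
  shows "compact (couplings w w')"
proof -
  have "closed (couplings w w')"
    unfolding couplings_def
    by (intro closed_Collect_conj closed_Collect_all;
        intro closed_Collect_le closed_Collect_eq continuous_on_const continuous_on_sum
          continuous_on_component continuous_on_id)
  moreover have "bounded (couplings w w')"
  proof -
    have "norm P \<le> (\<Sum>i\<in>UNIV. w $ i)" if P: "P \<in> couplings w w'" for P
    proof -
      have "norm P \<le> (\<Sum>i\<in>UNIV. norm (P $ i))"
        by (simp add: norm_vec_def L2_set_le_sum)
      also have "\<dots> \<le> (\<Sum>i\<in>UNIV. \<Sum>j\<in>UNIV. norm (P $ i $ j))"
        by (intro sum_mono) (simp add: norm_vec_def L2_set_le_sum)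
      also have "\<dots> = (\<Sum>i\<in>UNIV. w $ i)"
        using P by (intro sum.cong refl) (simp add: couplings_def)
      finally show ?thesis .
    qed
    then show ?thesis by (auto simp: bounded_iff)
  qed
  ultimately show ?thesis by (simp add: compact_eq_bounded_closed)
qed

lemma COOT_attained:
  fixes X :: "real^'d^'n" and X' :: "real^'e^'m"
  assumes "w \<in> prob_vectors" "w' \<in> prob_vectors" "v \<in> prob_vectors" "v' \<in> prob_vectors"
  obtains Ps Pv where "Ps \<in> couplings w w'" "Pv \<in> couplings v v'"
    "COOT L w w' v v' X X' = COOT_cost L X X' Ps Pv"
    "\<And>Qs Qv. Qs \<in> couplings w w' \<Longrightarrow> Qv \<in> couplings v v' \<Longrightarrow>
       COOT L w w' v v' X X' \<le> COOT_cost L X X' Qs Qv"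
proof -
  let ?K = "couplings w w' \<times> couplings v v'"
  let ?f = "\<lambda>x. case x of (Ps, Pv) \<Rightarrow> COOT_cost L X X' Ps Pv"
  have "compact ?K" by (intro compact_Times compact_couplings)
  moreover have "?K \<noteq> {}" using assms by (simp add: couplings_nonempty)
  moreover have "continuous_on ?K ?f"
    unfolding COOT_cost_def case_prod_beta
    by (intro continuous_on_sum continuous_on_mult continuous_on_const continuous_on_component
        continuous_on_fst continuous_on_snd continuous_on_id)
  ultimately obtain x where x: "x \<in> ?K" and min: "\<And>y. y \<in> ?K \<Longrightarrow> ?f x \<le> ?f y"
    using continuous_attains_inf[of ?K ?f] by blast
  have eq: "COOT L w w' v v' X X' = ?f x"
    unfolding COOT_def by (rule cInf_eq_minimum) (use x min in auto)
  show thesis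
  proof (rule that[of "fst x" "snd x"])
    show "COOT L w w' v v' X X' \<le> COOT_cost L X X' Qs Qv"
      if "Qs \<in> couplings w w'" "Qv \<in> couplings v v'" for Qs Qv
      using eq min[of "(Qs, Qv)"] that by simp
  qed (use x eq in \<open>auto simp: case_prod_beta\<close>)
qed

end

theory Submission
  imports Defs
begin

text \<open>For the triangle inequality, optimal couplings are glued along the middle marginal:
  \<open>T i j m = P i j * P' j m / w' j\<close> has marginals \<open>P\<close> and \<open>P'\<close>, and its third marginal is a
  coupling between the outer weights. If the optimal cost vanishes, the matrices agree on the
  supports of the two optimal couplings; with uniform weights these supports satisfy Hall's
  condition, so each of them contains the graph of a permutation.\<close>

section \<open>Marginals, transposition and symmetry\<close>

lemma COOT_cost_eq:
  "COOT_cost L X X' P V =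
     (\<Sum>i\<in>UNIV. \<Sum>j\<in>UNIV. P $ i $ j * (\<Sum>k\<in>UNIV. \<Sum>l\<in>UNIV. V $ k $ l * L (X $ i $ k) (X' $ j $ l)))"
  by (simp add: COOT_cost_def sum_distrib_left mult_ac)

lemma couplings_nonneg: "P \<in> couplings w w' \<Longrightarrow> 0 \<le> P $ i $ j"
  by (simp add: couplings_def)

lemma couplings_row_sum: "P \<in> couplings w w' \<Longrightarrow> (\<Sum>j\<in>UNIV. P $ i $ j) = w $ i"
  by (simp add: couplings_def)

lemma couplings_column_sum: "P \<in> couplings w w' \<Longrightarrow> (\<Sum>i\<in>UNIV. P $ i $ j) = w' $ j"
  by (simp add: couplings_def)

lemma transpose_in_couplings: "transpose P \<in> couplings w' w \<longleftrightarrow> P \<in> couplings w w'"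
  by (auto simp: couplings_def transpose_def)

lemma COOT_cost_transpose:
  assumes "\<And>a b. L a b = L b a"
  shows "COOT_cost L X' X (transpose P) (transpose V) = COOT_cost L X X' P V"
proof -
  have "(\<Sum>k\<in>UNIV. \<Sum>l\<in>UNIV. transpose V $ k $ l * L (X' $ i $ k) (X $ j $ l)) =
      (\<Sum>k\<in>UNIV. \<Sum>l\<in>UNIV. V $ k $ l * L (X $ j $ k) (X' $ i $ l))" for i j
    by (subst sum.swap) (simp add: transpose_def assms[of "X' $ _ $ _"])
  then show ?thesis
    unfolding COOT_cost_eq by (subst sum.swap) (simp add: transpose_def)
qed

lemma COOT_commute:
  assumes "\<And>a b. L a b = L b a"
  shows "COOT L w w' v v' X X' = COOT L w' w v' v X' X"
proof -
  \<comment> \<open>Cost, weights and matrices are generalised here, so that both inclusions between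
    the two sets of attainable costs are instances of one fact.\<close>
  have "(\<lambda>(P, V). COOT_cost L X X' P V) ` (couplings w w' \<times> couplings v v')
      \<subseteq> (\<lambda>(P, V). COOT_cost L X' X P V) ` (couplings w' w \<times> couplings v' v)"
    if "\<And>a b. L a b = L b a" for L :: "real \<Rightarrow> real \<Rightarrow> real" and w w' v v' X X'
  proof clarsimp
    fix P V assume "P \<in> couplings w w'" "V \<in> couplings v v'"
    then show "COOT_cost L X X' P V
        \<in> (\<lambda>(P, V). COOT_cost L X' X P V) ` (couplings w' w \<times> couplings v' v)"
      by (intro image_eqI[of _ _ "(transpose P, transpose V)"])
        (simp_all add: transpose_in_couplings COOT_cost_transpose[OF that])
  qed
  from equalityI[OF this[OF assms] this[OF assms]] show ?thesis
    unfolding COOT_def by (rule arg_cong)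
qed

section \<open>Gluing couplings and the triangle inequality\<close>

definition glue :: "real^'m^'n \<Rightarrow> real^'m \<Rightarrow> real^'k^'m \<Rightarrow> 'n \<Rightarrow> 'm \<Rightarrow> 'k \<Rightarrow> real" where
  "glue P w Q i j m = P $ i $ j * Q $ j $ m / w $ j"

definition glued_coupling :: "real^'m^'n \<Rightarrow> real^'m \<Rightarrow> real^'k^'m \<Rightarrow> real^'k^'n" where
  "glued_coupling P w Q = (\<chi> i m. \<Sum>j\<in>UNIV. glue P w Q i j m)"

text \<open>Division by zero gives 0, so \<open>glue\<close> vanishes wherever the middle weight
  does. This lemma and the next one show that both couplings vanish there too, so the marginals of
  \<open>glue\<close> remain correct.\<close>

lemma couplings_eq_0_of_column:
  assumes "P \<in> couplings w w'" "w' $ j = 0"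
  shows "P $ i $ j = 0"
  using assms sum_nonneg_eq_0_iff[of UNIV "\<lambda>i. P $ i $ j"] by (simp add: couplings_def)

lemma couplings_eq_0_of_row:
  assumes "P \<in> couplings w w'" "w $ i = 0"
  shows "P $ i $ j = 0"
  using couplings_eq_0_of_column[of "transpose P" w' w i j] assms
  by (simp add: transpose_in_couplings) (simp add: transpose_def)

context
  fixes P Q w w' w''
  assumes P: "P \<in> couplings w w'" and Q: "Q \<in> couplings w' w''"
begin

lemma glue_nonneg: "0 \<le> glue P w' Q i j m"
proof -
  \<comment> \<open>The middle weight is nonnegative because it is a row sum of
    \<open>Q\<close>.\<close>
  have "0 \<le> w' $ j"
    using couplings_row_sum[OF Q, of j] couplings_nonneg[OF Q] by (metis sum_nonneg)
  then show ?thesis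
    by (simp add: glue_def couplings_nonneg[OF P] couplings_nonneg[OF Q])
qed

lemma glue_sum_right: "(\<Sum>m\<in>UNIV. glue P w' Q i j m) = P $ i $ j"
  using couplings_eq_0_of_column[OF P, of j i]
  by (simp add: glue_def couplings_row_sum[OF Q] flip: sum_divide_distrib sum_distrib_left)

lemma glue_sum_left: "(\<Sum>i\<in>UNIV. glue P w' Q i j m) = Q $ j $ m"
  using couplings_eq_0_of_row[OF Q, of j m]
  by (simp add: glue_def couplings_column_sum[OF P] flip: sum_divide_distrib sum_distrib_right)

lemma glued_coupling_in_couplings: "glued_coupling P w' Q \<in> couplings w w''"
proof -
  have "(\<Sum>m\<in>UNIV. \<Sum>j\<in>UNIV. glue P w' Q i j m) = w $ i" for i
    by (subst sum.swap) (simp add: glue_sum_right couplings_row_sum[OF P])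
  moreover have "(\<Sum>i\<in>UNIV. \<Sum>j\<in>UNIV. glue P w' Q i j m) = w'' $ m" for m
    by (subst sum.swap) (simp add: glue_sum_left couplings_column_sum[OF Q])
  ultimately show ?thesis
    by (simp add: couplings_def glued_coupling_def glue_nonneg sum_nonneg)
qed

text \<open>Average the pointwise bound over \<open>glue\<close>: summing out \<open>m\<close>
  leaves \<open>f\<close> weighted by \<open>P\<close>, and summing out \<open>i\<close> leaves
  \<open>g\<close> weighted by \<open>Q\<close>. The functions are arbitrary so that the bound can
  be nested.\<close>

lemma glued_coupling_expectation_le:
  assumes le: "\<And>i j m. h i m \<le> f i j + g j m"
  shows "(\<Sum>i\<in>UNIV. \<Sum>m\<in>UNIV. glued_coupling P w' Q $ i $ m * h i m)
    \<le> (\<Sum>i\<in>UNIV. \<Sum>j\<in>UNIV. P $ i $ j * f i j) + (\<Sum>j\<in>UNIV. \<Sum>m\<in>UNIV. Q $ j $ m * g j m)"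
proof -
  let ?T = "glue P w' Q"
  have "(\<Sum>i\<in>UNIV. \<Sum>m\<in>UNIV. glued_coupling P w' Q $ i $ m * h i m)
      = (\<Sum>i\<in>UNIV. \<Sum>m\<in>UNIV. \<Sum>j\<in>UNIV. ?T i j m * h i m)"
    by (simp add: glued_coupling_def sum_distrib_right)
  also have "\<dots> = (\<Sum>i\<in>UNIV. \<Sum>j\<in>UNIV. \<Sum>m\<in>UNIV. ?T i j m * h i m)"
    by (intro sum.cong refl sum.swap)
  also have "\<dots> \<le> (\<Sum>i\<in>UNIV. \<Sum>j\<in>UNIV. \<Sum>m\<in>UNIV. ?T i j m * (f i j + g j m))"
    by (intro sum_mono mult_left_mono le glue_nonneg)
  also have "\<dots> = (\<Sum>i\<in>UNIV. \<Sum>j\<in>UNIV. \<Sum>m\<in>UNIV. ?T i j m * f i j)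
      + (\<Sum>i\<in>UNIV. \<Sum>j\<in>UNIV. \<Sum>m\<in>UNIV. ?T i j m * g j m)"
    by (simp add: distrib_left sum.distrib)
  \<comment> \<open>Moving \<open>i\<close> innermost makes \<open>glue_sum_left\<close>
    applicable.\<close>
  also have "(\<Sum>i\<in>UNIV. \<Sum>j\<in>UNIV. \<Sum>m\<in>UNIV. ?T i j m * g j m)
      = (\<Sum>j\<in>UNIV. \<Sum>m\<in>UNIV. \<Sum>i\<in>UNIV. ?T i j m * g j m)"
    by (subst sum.swap) (intro sum.cong refl sum.swap)
  finally show ?thesis
    by (simp add: glue_sum_left glue_sum_right flip: sum_distrib_right)
qed

end

text \<open>By \<open>COOT_cost_eq\<close> the cost is a sample average of feature averages. The
  gluing bound applies at both levels: the inner use, on features, supplies the pointwise hypothesis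
  of the outer one, on samples.\<close>

lemma COOT_cost_glued_coupling_le:
  assumes "\<And>a b c. L a c \<le> L a b + L b c"
    and "P \<in> couplings w w'" "Q \<in> couplings w' w''"
    and "V \<in> couplings v v'" "W \<in> couplings v' v''"
  shows "COOT_cost L X X'' (glued_coupling P w' Q) (glued_coupling V v' W)
    \<le> COOT_cost L X X' P V + COOT_cost L X' X'' Q W"
  unfolding COOT_cost_eq
  by (intro glued_coupling_expectation_le[OF assms(2,3)]
      glued_coupling_expectation_le[OF assms(4,5)] assms(1))

lemma COOT_triangle:
  assumes "\<And>a b c. L a c \<le> L a b + L b c"
    and w: "w \<in> prob_vectors" "w' \<in> prob_vectors" "w'' \<in> prob_vectors"
    and v: "v \<in> prob_vectors" "v' \<in> prob_vectors" "v'' \<in> prob_vectors"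
  shows "COOT L w w'' v v'' X X'' \<le> COOT L w w' v v' X X' + COOT L w' w'' v' v'' X' X''"
proof -
  obtain P V where PV: "P \<in> couplings w w'" "V \<in> couplings v v'"
    "COOT L w w' v v' X X' = COOT_cost L X X' P V"
    using COOT_attained w v by metis
  obtain Q W where QW: "Q \<in> couplings w' w''" "W \<in> couplings v' v''"
    "COOT L w' w'' v' v'' X' X'' = COOT_cost L X' X'' Q W"
    using COOT_attained w v by metis
  have "glued_coupling P w' Q \<in> couplings w w''" "glued_coupling V v' W \<in> couplings v v''"
    using PV QW by (simp_all add: glued_coupling_in_couplings)
  then have "COOT L w w'' v v'' X X''
      \<le> COOT_cost L X X'' (glued_coupling P w' Q) (glued_coupling V v' W)"
    using COOT_attained[where L = L and X = X and X' = X'', OF w(1,3) v(1,3)] by blast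
  also have "\<dots> \<le> COOT_cost L X X' P V + COOT_cost L X' X'' Q W"
    using assms(1) PV(1) QW(1) PV(2) QW(2) by (rule COOT_cost_glued_coupling_le)
  finally show ?thesis
    using PV QW by simp
qed

section \<open>Hall's marriage theorem\<close>

text \<open>Rado's argument: if a set \<open>A x\<close> contains two elements, one of them can be deleted without
  violating Hall's condition, for otherwise submodularity of \<open>J \<mapsto> card (\<Union> (A ` J))\<close> fails.\<close>

lemma hall_marriage:
  fixes A :: "'a \<Rightarrow> 'b set"
  assumes "finite I" and "\<And>i. i \<in> I \<Longrightarrow> finite (A i)"
    and "\<And>J. J \<subseteq> I \<Longrightarrow> card J \<le> card (\<Union> (A ` J))"
  shows "\<exists>f. inj_on f I \<and> (\<forall>i\<in>I. f i \<in> A i)"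
  using assms(2,3)
\<comment> \<open>The total size of the sets drops strictly with each deletion.\<close>
proof (induction "\<Sum>i\<in>I. card (A i)" arbitrary: A rule: less_induct)
  case less
  note fin = less.prems(1) and hall = less.prems(2)
  show ?case
  proof (cases "\<exists>x\<in>I. \<exists>y\<in>A x. \<exists>z\<in>A x. y \<noteq> z")
    case False
    \<comment> \<open>Here no set has two elements. Hall's condition on singletons makes each set
      nonempty, and on pairs it makes the choice injective.\<close>
    have "card (A i) \<ge> 1" if "i \<in> I" for i
      using hall[of "{i}"] that by simp
    then have "\<forall>i\<in>I. \<exists>y. y \<in> A i"
      by (metis all_not_in_conv card.empty not_one_le_zero)
    then obtain f where f: "\<forall>i\<in>I. f i \<in> A i"
      by metis
    have "inj_on f I"
    proof (rule inj_onI)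
      fix i j assume ij: "i \<in> I" "j \<in> I" "f i = f j"
      have "A i \<union> A j \<subseteq> {f i}"
        using False f ij by (metis Un_iff singletonI subsetI)
      then have "card (A i \<union> A j) \<le> 1"
        using card_mono[of "{f i}"] by fastforce
      then show "i = j"
        using hall[of "{i, j}"] ij by (cases "i = j") auto
    qed
    with f show ?thesis by blast
  next
    case True
    then obtain x y z where x: "x \<in> I" and yz: "y \<in> A x" "z \<in> A x" "y \<noteq> z"
      by blast
    let ?del = "\<lambda>u. A(x := A x - {u})"
    have hall_del: "\<exists>f. inj_on f I \<and> (\<forall>i\<in>I. f i \<in> A i)"
      if u: "u \<in> A x" and hall': "\<And>J. J \<subseteq> I \<Longrightarrow> card J \<le> card (\<Union> (?del u ` J))" for u
    proof -
      have "(\<Sum>i\<in>I. card (?del u i)) < (\<Sum>i\<in>I. card (A i))"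
      proof (rule sum_strict_mono_ex1)
        show "\<forall>i\<in>I. card (?del u i) \<le> card (A i)"
          using fin by (auto intro: card_mono)
        show "\<exists>i\<in>I. card (?del u i) < card (A i)"
          using x u fin by (intro bexI[of _ x]) (simp_all only: fun_upd_same card_Diff1_less)
      qed (fact assms(1))
      moreover have "\<And>i. i \<in> I \<Longrightarrow> finite (?del u i)"
        using fin by auto
      ultimately obtain f where "inj_on f I" "\<forall>i\<in>I. f i \<in> ?del u i"
        using less.hyps hall' by blast
      then show ?thesis
        by (metis DiffD1 fun_upd_apply)
    qed
    \<comment> \<open>Deletion changes only \<open>A x\<close>, so a violating set must contain
      \<open>x\<close>. Dropping \<open>x\<close> from it lowers its size by one, which turns the
      strict inequality into a weak one.\<close>
    have violated: "\<exists>J\<subseteq>I - {x}. card (\<Union> (A ` J) \<union> (A x - {u})) \<le> card J"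
      if J: "J \<subseteq> I" "\<not> card J \<le> card (\<Union> (?del u ` J))" for u J
    proof -
      have "x \<in> J"
      proof (rule ccontr)
        assume "x \<notin> J"
        then have "?del u ` J = A ` J" by auto
        with J hall show False by metis
      qed
      moreover have "finite J"
        using J assms(1) finite_subset by blast
      moreover from \<open>x \<in> J\<close> have "\<Union> (?del u ` J) = \<Union> (A ` (J - {x})) \<union> (A x - {u})"
        by (auto split: if_splits)
      ultimately show ?thesis
        using J by (intro exI[of _ "J - {x}"]) auto
    qed
    show ?thesis
    proof (rule ccontr)
      assume contra: "\<nexists>f. inj_on f I \<and> (\<forall>i\<in>I. f i \<in> A i)"
      obtain J where J: "J \<subseteq> I - {x}" "card (\<Union> (A ` J) \<union> (A x - {y})) \<le> card J"
        using hall_del[OF yz(1)] contra violated by meson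
      obtain K where K: "K \<subseteq> I - {x}" "card (\<Union> (A ` K) \<union> (A x - {z})) \<le> card K"
        using hall_del[OF yz(2)] contra violated by meson
      let ?S = "\<Union> (A ` J) \<union> (A x - {y})" and ?T = "\<Union> (A ` K) \<union> (A x - {z})"
      have finJK: "finite J" "finite K"
        using J K assms(1) by (meson finite_Diff finite_subset)+
      have finST: "finite ?S" "finite ?T"
        using finJK J K x fin by (auto intro!: finite_UN_I)
      \<comment> \<open>Since \<open>y\<close> and \<open>z\<close> differ, the two reduced copies
        of \<open>A x\<close> together recover all of it. Hall's condition then applies to a set
        with the extra index \<open>x\<close>, and this surplus of one gives the
        contradiction.\<close>
      have "?S \<union> ?T = \<Union> (A ` insert x (J \<union> K))"
        using yz by auto
      then have "card (?S \<union> ?T) = card (\<Union> (A ` insert x (J \<union> K)))"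
        by (rule arg_cong)
      moreover have "card (insert x (J \<union> K)) \<le> card (\<Union> (A ` insert x (J \<union> K)))"
        using J K x by (intro hall) auto
      moreover have "card (insert x (J \<union> K)) = Suc (card (J \<union> K))"
        using J K finJK by (subst card_insert_disjoint) auto
      moreover have "card (J \<inter> K) \<le> card (\<Union> (A ` (J \<inter> K)))"
        using J by (intro hall) auto
      moreover have "card (\<Union> (A ` (J \<inter> K))) \<le> card (?S \<inter> ?T)"
        using finST by (intro card_mono) auto
      ultimately have "Suc (card (J \<union> K) + card (J \<inter> K)) \<le> card (?S \<union> ?T) + card (?S \<inter> ?T)"
        by linarith
      also have "\<dots> = card ?S + card ?T"
        using card_Un_Int[OF finST] by simp
      also have "\<dots> \<le> card J + card K"
        using J K by linarith
      also have "\<dots> = card (J \<union> K) + card (J \<inter> K)"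
        using card_Un_Int[OF finJK] .
      finally show False by simp
    qed
  qed
qed

section \<open>Zero cost and permutations\<close>

lemma uniform_coupling_support_permutation:
  fixes P :: "real^'n^'n"
  assumes P: "P \<in> couplings uniform_weights uniform_weights"
  obtains \<sigma> where "\<sigma> permutes UNIV" "\<And>i. P $ i $ \<sigma> i > 0"
proof -
  let ?A = "\<lambda>i. {j. P $ i $ j > 0}"
  \<comment> \<open>Double counting of mass: the rows in \<open>J\<close> carry
    \<open>card J / n\<close>, all of it in the columns of \<open>?B\<close>, whose total mass is
    \<open>card ?B / n\<close>.\<close>
  have "card J \<le> card (\<Union> (?A ` J))" for J
  proof -
    let ?B = "\<Union> (?A ` J)"
    have "real (card J) / CARD('n) = (\<Sum>i\<in>J. \<Sum>j\<in>UNIV. P $ i $ j)"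
      by (simp add: couplings_row_sum[OF P] uniform_weights_def)
    also have "\<dots> = (\<Sum>i\<in>J. \<Sum>j\<in>?B. P $ i $ j)"
      using couplings_nonneg[OF P]
      by (intro sum.cong refl sum.mono_neutral_right) (auto simp: less_le)
    also have "\<dots> \<le> (\<Sum>i\<in>UNIV. \<Sum>j\<in>?B. P $ i $ j)"
      by (intro sum_mono2 sum_nonneg couplings_nonneg[OF P]) auto
    also have "\<dots> = (\<Sum>j\<in>?B. \<Sum>i\<in>UNIV. P $ i $ j)"
      by (rule sum.swap)
    also have "\<dots> = real (card ?B) / CARD('n)"
      by (simp add: couplings_column_sum[OF P] uniform_weights_def)
    finally show ?thesis
      by (simp add: divide_le_cancel)
  qed
  then obtain \<sigma> where "inj \<sigma>" and pos: "\<And>i. P $ i $ \<sigma> i > 0"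
    using hall_marriage[of UNIV ?A] by auto
  then have "\<sigma> permutes UNIV"
    by (intro bij_imp_permutes) (simp_all add: bij_def finite_UNIV_inj_surj)
  with pos that show ?thesis by blast
qed

lemma permutation_coupling:
  fixes \<sigma> :: "'n \<Rightarrow> 'n::finite"
  assumes "\<sigma> permutes UNIV"
  shows "(\<chi> i j. if j = \<sigma> i then 1 / real CARD('n) else 0) \<in> couplings uniform_weights uniform_weights"
proof -
  \<comment> \<open>Solving for \<open>i\<close> reduces the column sum to the single entry at
    \<open>inv \<sigma> j\<close>.\<close>
  have "(j = \<sigma> i) = (i = inv \<sigma> j)" for i j
    using permutes_inverses[OF assms] by metis
  then have "(\<Sum>i\<in>UNIV. if j = \<sigma> i then 1 / real CARD('n) else 0) = 1 / real CARD('n)" for j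
    by simp
  then show ?thesis
    by (simp add: couplings_def uniform_weights_def)
qed

lemma COOT_cost_nonneg:
  assumes "\<And>a b. 0 \<le> L a b" "P \<in> couplings w w'" "V \<in> couplings v v'"
  shows "0 \<le> COOT_cost L X X' P V"
  unfolding COOT_cost_def
  by (intro sum_nonneg mult_nonneg_nonneg assms(1) couplings_nonneg[OF assms(2)]
      couplings_nonneg[OF assms(3)])

text \<open>A vanishing sum of nonnegative terms has only zero terms, and the positive masses can be
  cancelled.\<close>

lemma COOT_cost_eq_0D:
  assumes "\<And>a b. 0 \<le> L a b" "P \<in> couplings w w'" "V \<in> couplings v v'"
    and "COOT_cost L X X' P V = 0" and "P $ i $ j > 0" "V $ k $ l > 0"
  shows "L (X $ i $ k) (X' $ j $ l) = 0"
proof -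
  have nonneg: "0 \<le> L (X $ i $ k) (X' $ j $ l) * P $ i $ j * V $ k $ l" for i j k l
    by (intro mult_nonneg_nonneg assms(1) couplings_nonneg[OF assms(2)] couplings_nonneg[OF assms(3)])
  have "L (X $ i $ k) (X' $ j $ l) * P $ i $ j * V $ k $ l = 0"
    using assms(4) unfolding COOT_cost_def
    by (simp add: sum_nonneg_eq_0_iff sum_nonneg nonneg)
  with assms(5,6) show ?thesis by simp
qed

text \<open>Permutations inside the supports of an optimal pair give the matching; conversely, the
  couplings on the graphs of the given permutations have cost zero.\<close>

lemma COOT_uniform_eq_0_iff:
  fixes X X' :: "real^'d^'n"
  assumes L_nonneg: "\<And>a b. 0 \<le> L a b" and L_eq_0: "\<And>a b. L a b = 0 \<longleftrightarrow> a = b"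
  shows "COOT L uniform_weights uniform_weights uniform_weights uniform_weights X X' = 0 \<longleftrightarrow>
    (\<exists>\<sigma> \<tau>. \<sigma> permutes UNIV \<and> \<tau> permutes UNIV \<and> (\<forall>i k. X $ i $ k = X' $ (\<sigma> i) $ (\<tau> k)))"
    (is "?C = 0 \<longleftrightarrow> ?R")
proof -
  obtain P :: "real^'n^'n" and V :: "real^'d^'d" where
    P: "P \<in> couplings uniform_weights uniform_weights" and
    V: "V \<in> couplings uniform_weights uniform_weights" and
    C: "?C = COOT_cost L X X' P V" and
    C_le: "\<And>Q W. Q \<in> couplings uniform_weights uniform_weights \<Longrightarrow>
      W \<in> couplings uniform_weights uniform_weights \<Longrightarrow> ?C \<le> COOT_cost L X X' Q W"
    by (rule COOT_attained[where L = L and X = X and X' = X', OF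
          uniform_weights_in_prob_vectors uniform_weights_in_prob_vectors
          uniform_weights_in_prob_vectors uniform_weights_in_prob_vectors]) blast
  show ?thesis
  proof
    assume "?C = 0"
    obtain \<sigma> where \<sigma>: "\<sigma> permutes UNIV" "\<And>i. P $ i $ \<sigma> i > 0"
      using uniform_coupling_support_permutation[OF P] by blast
    obtain \<tau> where \<tau>: "\<tau> permutes UNIV" "\<And>k. V $ k $ \<tau> k > 0"
      using uniform_coupling_support_permutation[OF V] by blast
    have "X $ i $ k = X' $ \<sigma> i $ \<tau> k" for i k
      using COOT_cost_eq_0D[OF L_nonneg P V _ \<sigma>(2) \<tau>(2)] C \<open>?C = 0\<close> L_eq_0 by simp
    with \<sigma> \<tau> show ?R by blast
  next
    assume ?R
    then obtain \<sigma> \<tau> where \<sigma>: "\<sigma> permutes UNIV" and \<tau>: "\<tau> permutes UNIV"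
      and eq: "\<And>i k. X $ i $ k = X' $ (\<sigma> i) $ (\<tau> k)"
      by blast
    let ?Q = "\<chi> i j. if j = \<sigma> i then 1 / real CARD('n) else 0"
    let ?W = "\<chi> k l. if l = \<tau> k then 1 / real CARD('d) else 0"
    have "?C \<le> COOT_cost L X X' ?Q ?W"
      by (intro C_le permutation_coupling \<sigma> \<tau>)
    also have "\<dots> = 0"
      \<comment> \<open>Each summand vanishes: on the two graphs the matrix entries agree, and
        elsewhere one of the masses is 0.\<close>
      unfolding COOT_cost_def by (intro sum.neutral ballI) (simp add: eq L_eq_0)
    finally show "?C = 0"
      using COOT_cost_nonneg[where L = L and X = X and X' = X', OF L_nonneg P V] C by simp
  qed
qed

theorem proposition5p3p1:
  fixes p :: real
    and L :: "real \<Rightarrow> real \<Rightarrow> real"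
    and w w' w'' :: "real^'n"
    and v v' v'' :: "real^'d"
  assumes "p \<ge> 1"
    and "L = (\<lambda>a b. \<bar>a - b\<bar> powr p)"
    and "w = uniform_weights" and "w' = uniform_weights" and "w'' = uniform_weights"
    and "v = uniform_weights" and "v' = uniform_weights" and "v'' = uniform_weights"
  shows "(\<forall>X X' :: real^'d^'n.
            COOT L w w' v v' X X' = 0 \<longleftrightarrow>
            (\<exists>\<sigma>\<^sub>1 \<sigma>\<^sub>2. \<sigma>\<^sub>1 permutes UNIV \<and> \<sigma>\<^sub>2 permutes UNIV \<and>
               (\<forall>i k. X $ i $ k = X' $ (\<sigma>\<^sub>1 i) $ (\<sigma>\<^sub>2 k))))
       \<and> (\<forall>X X' :: real^'d^'n. COOT L w w' v v' X X' = COOT L w' w v' v X' X)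
       \<and> ((\<forall>a b c. L a c \<le> L a b + L b c) \<longrightarrow>
            (\<forall>X X' X'' :: real^'d^'n.
               COOT L w w'' v v'' X X'' \<le> COOT L w w' v v' X X' + COOT L w' w'' v' v'' X' X''))"
proof -
  have L_nonneg: "0 \<le> L a b" and L_eq_0: "L a b = 0 \<longleftrightarrow> a = b" and L_commute: "L a b = L b a" for a b
    by (simp_all add: assms(2) abs_minus_commute)
  show ?thesis
    unfolding assms(3-8)
    by (intro conjI allI impI COOT_uniform_eq_0_iff[OF L_nonneg L_eq_0] COOT_commute[OF L_commute]
        COOT_triangle uniform_weights_in_prob_vectors) blast
qed

end
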